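(* Let $\sigma>0$, $n\ge1$, and consider the scalar scale-mixture model $\lambda\sim\Pi_\lambda$ with $\lambda>0$, $\theta\mid\lambda\sim N(0,\lambda^2)$, $Y\mid\theta,\lambda\sim N(\theta,\sigma^2/n)$ (so that $\lambda\to\theta\to Y$ is a Markov chain). Then \[ I(\theta;Y)=I(\lambda;Y)+I(\theta;Y\mid\lambda)=I(\lambda;Y)+\frac12\,\mathbb E_\lambda\log\left(1+\frac{n\lambda^2}{\sigma^2}\right). \]
   Context: $I(U;V)=\mathrm{KL}(P_{U,V}\,\|\,P_U\otimes P_V)$ is mutual information (natural logarithm), with values in $[0,\infty]$, and $I(\theta;Y\mid\lambda)$ is the conditional mutual information, i.e. the average over $\lambda\sim\Pi_\lambda$ of the mutual information between $\theta$ and $Y$ under their conditional joint law given $\lambda$. *)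

theory Defs
  imports "HOL-Probability.Probability"
begin

text \<open>
  The library's \<open>KL_divergence\<close> and \<open>mutual_information\<close> are real-valued, so they take a
  meaningless value where the true value is infinite; the versions below take values in
  \<open>[0, \<infinity>]\<close>. For probability measures \<open>P\<close> and \<open>Q\<close> with \<open>P\<close> absolutely continuous
  with respect to \<open>Q\<close>, the negative part of \<open>ln (dP/dQ)\<close> is always \<open>P\<close>-integrable,
  so the integral is infinite exactly when the integrability test fails.
  In \<open>KL_divergence b Q P\<close> the reference measure comes first; base \<open>exp 1\<close> gives the
  natural logarithm.
\<close>

definition KL :: "'a measure \<Rightarrow> 'a measure \<Rightarrow> ennreal" where
  "KL P Q =
     (if absolutely_continuous Q P \<and> integrable P (entropy_density (exp 1) Q P)
      then ennreal (KL_divergence (exp 1) Q P) else \<infinity>)"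

definition mutual_info ::
  "'w measure \<Rightarrow> 'a measure \<Rightarrow> 'b measure \<Rightarrow> ('w \<Rightarrow> 'a) \<Rightarrow> ('w \<Rightarrow> 'b) \<Rightarrow> ennreal" where
  "mutual_info M S T X Y =
     KL (distr M (S \<Otimes>\<^sub>M T) (\<lambda>w. (X w, Y w))) (distr M S X \<Otimes>\<^sub>M distr M T Y)"

text \<open>
  \<open>K\<close> is a regular conditional law of \<open>X\<close> (valued in \<open>S\<close>) given \<open>Z\<close> (valued in \<open>U\<close>).
  Taking \<open>B = space S\<close> forces \<open>K z\<close> to be a probability measure for almost every \<open>z\<close>;
  \<open>subprob_algebra\<close> only leaves room for degenerate values on a null set.
\<close>

definition is_cond_law ::
  "'w measure \<Rightarrow> 'a measure \<Rightarrow> 'c measure \<Rightarrow> ('w \<Rightarrow> 'a) \<Rightarrow> ('w \<Rightarrow> 'c) \<Rightarrow> ('c \<Rightarrow> 'a measure) \<Rightarrow> bool"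
where
  "is_cond_law M S U X Z K \<longleftrightarrow>
     K \<in> U \<rightarrow>\<^sub>M subprob_algebra S \<and>
     (\<forall>A\<in>sets U. \<forall>B\<in>sets S.
        emeasure M {w \<in> space M. Z w \<in> A \<and> X w \<in> B}
          = (\<integral>\<^sup>+z\<in>A. emeasure (K z) B \<partial>distr M U Z))"

text \<open>
  The choice of the conditional law is immaterial: on standard Borel spaces it exists and any two
  versions agree for almost every \<open>z\<close>.
\<close>

definition cond_mutual_info ::
  "'w measure \<Rightarrow> 'a measure \<Rightarrow> 'b measure \<Rightarrow> 'c measure \<Rightarrow>
   ('w \<Rightarrow> 'a) \<Rightarrow> ('w \<Rightarrow> 'b) \<Rightarrow> ('w \<Rightarrow> 'c) \<Rightarrow> ennreal" where
  "cond_mutual_info M S T U X Y Z =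
     (let K = (SOME K. is_cond_law M (S \<Otimes>\<^sub>M T) U (\<lambda>w. (X w, Y w)) Z K)
      in \<integral>\<^sup>+z. mutual_info (K z) S T fst snd \<partial>distr M U Z)"

text \<open>The second parameter is the variance, whereas \<open>normal_density\<close> takes the standard deviation.\<close>

definition gaussian :: "real \<Rightarrow> real \<Rightarrow> real measure" where
  "gaussian m v = density lborel (\<lambda>x. ennreal (normal_density m (sqrt v) x))"

end

theory Submission
  imports Defs
begin

text \<open>
  Put \<open>v = \<sigma>\<^sup>2 / n\<close> and write \<open>k\<close>, \<open>r\<close> and \<open>m\<close> for the densities of \<open>Y\<close> given \<open>\<theta>\<close>, given \<open>L\<close> and
  unconditionally; \<open>r\<close> is the density of \<open>N(0, L\<^sup>2 + v)\<close>. Then \<open>I(\<theta>;Y)\<close> is the expectation of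
  \<open>ln (k / m) = ln (r / m) + ln (k / r)\<close>, whose first summand has expectation \<open>I(L;Y)\<close>. The second one is
  \<open>ln (1 + L\<^sup>2 / v) / 2\<close> plus half the difference of the squares of the standardized variables
  \<open>Y / sqrt (L\<^sup>2 + v)\<close> and \<open>(Y - \<theta>) / sqrt v\<close>, both of expectation 1. All values may be infinite, so
  integrability is tracked through \<open>ln (r / m) \<ge> 1 - m / r\<close> and \<open>E (m / r) = 1\<close>.
\<close>

section \<open>Mutual information of variables with a joint density\<close>

text \<open>By uniqueness of Radon-Nikodym derivatives \<open>f\<close> is a version of
  \<open>RN_deriv Q P\<close>. The equality holds \<open>Q\<close>-almost everywhere, hence
  \<open>P\<close>-almost everywhere by absolute continuity. Positivity of \<open>f\<close> makes
  the passage through \<open>ennreal\<close> lossless.\<close>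

lemma KL_density_eq:
  fixes f :: "'a \<Rightarrow> real"
  assumes "sigma_finite_measure Q" and f[measurable]: "f \<in> borel_measurable Q"
    and pos: "\<And>x. x \<in> space Q \<Longrightarrow> 0 < f x"
    and P: "P = density Q (\<lambda>x. ennreal (f x))"
  shows "KL P Q = (if integrable P (\<lambda>x. ln (f x)) then ennreal (\<integral>x. ln (f x) \<partial>P) else \<infinity>)"
proof -
  interpret sigma_finite_measure Q by fact
  have sets_P[measurable_cong]: "sets P = sets Q" by (simp add: P)
  have ac: "absolutely_continuous Q P"
    unfolding P by (rule absolutely_continuousI_density) measurable
  have "AE x in Q. ennreal (f x) = RN_deriv Q P x"
    by (rule RN_deriv_unique) (auto simp: P)
  then have "AE x in Q. entropy_density (exp 1) Q P x = ln (f x)"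
    using AE_space
  proof eventually_elim
    case (elim x)
    then show ?case
      using pos[of x] by (simp add: entropy_density_def log_def elim(1)[symmetric])
  qed
  then have AE: "AE x in P. entropy_density (exp 1) Q P x = ln (f x)"
    using absolutely_continuous_AE[OF sets_P ac] by simp
  have "integrable P (entropy_density (exp 1) Q P) \<longleftrightarrow> integrable P (\<lambda>x. ln (f x))"
    by (rule integrable_cong_AE) (use AE in auto)
  moreover have "KL_divergence (exp 1) Q P = (\<integral>x. ln (f x) \<partial>P)"
    unfolding KL_divergence_def by (rule integral_cong_AE) (use AE in auto)
  ultimately show ?thesis
    using ac by (simp add: KL_def)
qed

text \<open>Here \<open>k x\<close> acts as the density of \<open>Y\<close> given
  \<open>X = x\<close> with respect to a reference measure \<open>N\<close>. The uniform bound makes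
  \<open>marginal\<close> finite at every point and positivity makes every logarithm genuine, so no
  exceptional sets arise when the logarithms are split.\<close>

locale joint_density = prob_space M + N: sigma_finite_measure N
  for M :: "'w measure" and S :: "'a measure" and N :: "'b measure"
    and X :: "'w \<Rightarrow> 'a" and Y :: "'w \<Rightarrow> 'b" and k :: "'a \<Rightarrow> 'b \<Rightarrow> real" +
  assumes X[measurable]: "X \<in> M \<rightarrow>\<^sub>M S" and Y[measurable]: "Y \<in> M \<rightarrow>\<^sub>M N"
    and k[measurable]: "(\<lambda>(x, y). k x y) \<in> borel_measurable (S \<Otimes>\<^sub>M N)"
    and k_pos: "\<And>x y. 0 < k x y"
    and k_bounded: "\<exists>C. \<forall>x y. k x y \<le> C"
    and joint: "distr M (S \<Otimes>\<^sub>M N) (\<lambda>w. (X w, Y w))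
                  = density (distr M S X \<Otimes>\<^sub>M N) (\<lambda>(x, y). ennreal (k x y))"
begin

definition marginal :: "'b \<Rightarrow> real" where
  "marginal y = (\<integral>w. k (X w) y \<partial>M)"

lemma measurable_marginal[measurable]: "marginal \<in> borel_measurable N"
  unfolding marginal_def by measurable

lemma integrable_k:
  assumes "y \<in> space N"
  shows "integrable M (\<lambda>w. k (X w) y)"
proof -
  obtain C where C: "\<And>x y. k x y \<le> C" using k_bounded by auto
  have [measurable]: "(\<lambda>w. k (X w) y) \<in> borel_measurable M"
    using assms by measurable
  show ?thesis
    by (rule integrable_const_bound[where B=C]) (use C k_pos in \<open>auto simp: less_imp_le\<close>)
qed

text \<open>A nonnegative function with integral 0 vanishes almost everywhere, which a strictly
  positive one cannot do on a probability space.\<close>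

lemma marginal_pos:
  assumes "y \<in> space N"
  shows "0 < marginal y"
proof -
  have "marginal y \<noteq> 0"
  proof
    assume "marginal y = 0"
    then have "AE w in M. k (X w) y = 0"
      unfolding marginal_def
      by (subst (asm) integral_nonneg_eq_0_iff_AE[OF integrable_k[OF assms]])
         (use k_pos in \<open>auto simp: less_imp_le\<close>)
    then have "AE w in M. False"
      by eventually_elim (use k_pos in \<open>auto simp: less_le\<close>)
    then show False
      by simp
  qed
  moreover have "0 \<le> marginal y"
    unfolding marginal_def by (rule Bochner_Integration.integral_nonneg) (simp add: k_pos less_imp_le)
  ultimately show ?thesis by simp
qed

lemma ennreal_marginal:
  assumes "y \<in> space N"
  shows "ennreal (marginal y) = (\<integral>\<^sup>+w. ennreal (k (X w) y) \<partial>M)"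
  unfolding marginal_def
  by (rule nn_integral_eq_integral[symmetric])
     (use integrable_k[OF assms] k_pos in \<open>auto simp: less_imp_le\<close>)

text \<open>Tonelli for the joint density: \<open>Y\<close> is integrated out first, for a fixed
  value of \<open>X\<close>. The law of \<open>Y\<close>, the mean of the inverse ratio and the
  second moments all come from this formula.\<close>

lemma nn_integral_joint:
  assumes g[measurable]: "g \<in> borel_measurable (S \<Otimes>\<^sub>M N)"
  shows "(\<integral>\<^sup>+w. g (X w, Y w) \<partial>M) = (\<integral>\<^sup>+w. \<integral>\<^sup>+y. ennreal (k (X w) y) * g (X w, y) \<partial>N \<partial>M)"
proof -
  have "(\<integral>\<^sup>+w. g (X w, Y w) \<partial>M) = (\<integral>\<^sup>+z. g z \<partial>distr M (S \<Otimes>\<^sub>M N) (\<lambda>w. (X w, Y w)))"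
    by (subst nn_integral_distr) auto
  also have "\<dots> = (\<integral>\<^sup>+z. ennreal (case_prod k z) * g z \<partial>(distr M S X \<Otimes>\<^sub>M N))"
    unfolding joint by (subst nn_integral_density) (auto simp: split_beta')
  also have "\<dots> = (\<integral>\<^sup>+x. \<integral>\<^sup>+y. ennreal (k x y) * g (x, y) \<partial>N \<partial>distr M S X)"
    by (subst N.nn_integral_fst[symmetric]) auto
  also have "\<dots> = (\<integral>\<^sup>+w. \<integral>\<^sup>+y. ennreal (k (X w) y) * g (X w, y) \<partial>N \<partial>M)"
    by (subst nn_integral_distr) auto
  finally show ?thesis .
qed

lemma distr_Y: "distr M N Y = density N (\<lambda>y. ennreal (marginal y))"
proof (rule measure_eqI)
  fix A assume "A \<in> sets (distr M N Y)"
  then have A[measurable]: "A \<in> sets N" by simp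
  interpret pair_sigma_finite N M
    by (intro pair_sigma_finite.intro N.sigma_finite_measure_axioms sigma_finite_measure_axioms)
  have "emeasure (distr M N Y) A = (\<integral>\<^sup>+y. indicator A y \<partial>distr M N Y)"
    by simp
  also have "\<dots> = (\<integral>\<^sup>+w. indicator A (Y w) \<partial>M)"
    by (subst nn_integral_distr) auto
  also have "\<dots> = (\<integral>\<^sup>+w. \<integral>\<^sup>+y. ennreal (k (X w) y) * indicator A y \<partial>N \<partial>M)"
    using nn_integral_joint[of "\<lambda>(x, y). indicator A y"] by simp
  also have "\<dots> = (\<integral>\<^sup>+y. \<integral>\<^sup>+w. ennreal (k (X w) y) * indicator A y \<partial>M \<partial>N)"
    by (rule Fubini') measurable
  also have "\<dots> = (\<integral>\<^sup>+y. ennreal (marginal y) * indicator A y \<partial>N)"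
    by (intro nn_integral_cong) (simp add: ennreal_marginal nn_integral_multc)
  finally show "emeasure (distr M N Y) A = emeasure (density N (\<lambda>y. ennreal (marginal y))) A"
    by (simp add: emeasure_density)
qed simp

text \<open>The product of the two marginal laws has density \<open>marginal y\<close> with respect
  to \<open>distr M S X \<Otimes>\<^sub>M N\<close>; as this is positive, dividing \<open>k\<close>
  by it changes the reference measure.\<close>

lemma joint_density_product:
  "distr M (S \<Otimes>\<^sub>M N) (\<lambda>w. (X w, Y w))
     = density (distr M S X \<Otimes>\<^sub>M distr M N Y) (\<lambda>z. ennreal (k (fst z) (snd z) / marginal (snd z)))"
proof -
  interpret dX: prob_space "distr M S X" by (rule prob_space_distr) simp
  interpret dY: prob_space "distr M N Y" by (rule prob_space_distr) simp
  \<comment> \<open>The law of \<open>X\<close> is written with the trivial density 1 so that the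
    rule for products of densities applies.\<close>
  have "distr M S X \<Otimes>\<^sub>M distr M N Y
      = density (distr M S X) (\<lambda>_. 1) \<Otimes>\<^sub>M density N (\<lambda>y. ennreal (marginal y))"
    by (simp add: distr_Y density_1)
  also have "\<dots> = density (distr M S X \<Otimes>\<^sub>M N) (\<lambda>(x, y). 1 * ennreal (marginal y))"
    by (rule pair_measure_density)
       (auto simp: distr_Y[symmetric] N.sigma_finite_measure_axioms dY.sigma_finite_measure_axioms)
  finally have *: "distr M S X \<Otimes>\<^sub>M distr M N Y
      = density (distr M S X \<Otimes>\<^sub>M N) (\<lambda>z. ennreal (marginal (snd z)))"
    by (simp add: split_beta')
  show ?thesis
    unfolding * joint
    apply (subst density_density_eq)
      apply (auto intro!: density_cong AE_I2
              simp: split_beta' space_pair_measure ennreal_mult'[symmetric] less_imp_le)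
    subgoal for x y
      using marginal_pos[of y] k_pos[of x y] by (simp add: ennreal_mult[symmetric] less_imp_le)
    done
qed

text \<open>Transporting the integral back to \<open>M\<close> lets the informations of different
  pairs of variables be compared as integrals over one space. The logarithm of the quotient is kept
  as a difference so that a common marginal cancels.\<close>

lemma mutual_info_eq:
  "mutual_info M S N X Y =
     (if integrable M (\<lambda>w. ln (k (X w) (Y w)) - ln (marginal (Y w)))
      then ennreal (\<integral>w. ln (k (X w) (Y w)) - ln (marginal (Y w)) \<partial>M) else \<infinity>)"
proof -
  interpret dX: prob_space "distr M S X" by (rule prob_space_distr) simp
  interpret dY: prob_space "distr M N Y" by (rule prob_space_distr) simp
  interpret dXY: pair_prob_space "distr M S X" "distr M N Y" ..
  let ?J = "distr M (S \<Otimes>\<^sub>M N) (\<lambda>w. (X w, Y w))"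
  let ?f = "\<lambda>z. k (fst z) (snd z) / marginal (snd z)"
  have KL: "mutual_info M S N X Y =
      (if integrable ?J (\<lambda>z. ln (?f z)) then ennreal (\<integral>z. ln (?f z) \<partial>?J) else \<infinity>)"
    unfolding mutual_info_def
    by (rule KL_density_eq[OF dXY.sigma_finite_measure_axioms _ _ joint_density_product])
       (use k_pos marginal_pos in \<open>auto simp: space_pair_measure\<close>)
  have *: "ln (?f (X w, Y w)) = ln (k (X w) (Y w)) - ln (marginal (Y w))" if "w \<in> space M" for w
    using k_pos[of "X w" "Y w"] marginal_pos[OF measurable_space[OF Y that]] by (simp add: ln_div)
  have "integrable ?J (\<lambda>z. ln (?f z)) \<longleftrightarrow> integrable M (\<lambda>w. ln (?f (X w, Y w)))"
    by (rule integrable_distr_eq) measurable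
  also have "\<dots> \<longleftrightarrow> integrable M (\<lambda>w. ln (k (X w) (Y w)) - ln (marginal (Y w)))"
    by (rule Bochner_Integration.integrable_cong[OF refl *])
  finally have 1: "integrable ?J (\<lambda>z. ln (?f z)) \<longleftrightarrow> \<dots>" .
  have "(\<integral>z. ln (?f z) \<partial>?J) = (\<integral>w. ln (?f (X w, Y w)) \<partial>M)"
    by (rule integral_distr) measurable
  also have "\<dots> = (\<integral>w. ln (k (X w) (Y w)) - ln (marginal (Y w)) \<partial>M)"
    by (rule Bochner_Integration.integral_cong[OF refl *])
  finally show ?thesis
    unfolding KL 1 by simp
qed

text \<open>Integrating \<open>k * (marginal / k)\<close> over \<open>y\<close> leaves the total
  mass of the law of \<open>Y\<close>. This gives an integrable control of the negative part of the
  log ratio.\<close>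

lemma has_bochner_integral_inverse_ratio:
  "has_bochner_integral M (\<lambda>w. marginal (Y w) / k (X w) (Y w)) 1"
proof (rule has_bochner_integral_nn_integral)
  have "(\<integral>\<^sup>+w. ennreal (marginal (Y w) / k (X w) (Y w)) \<partial>M)
      = (\<integral>\<^sup>+w. \<integral>\<^sup>+y. ennreal (k (X w) y) * ennreal (marginal y / k (X w) y) \<partial>N \<partial>M)"
    using nn_integral_joint[of "\<lambda>(x, y). ennreal (marginal y / k x y)"] by simp
  also have "\<dots> = (\<integral>\<^sup>+w. \<integral>\<^sup>+y. ennreal (marginal y) \<partial>N \<partial>M)"
    using k_pos marginal_pos
    by (intro nn_integral_cong) (simp add: ennreal_mult[symmetric] less_imp_le less_imp_neq[symmetric])
  also have "(\<integral>\<^sup>+y. ennreal (marginal y) \<partial>N) = emeasure (distr M N Y) (space N)"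
    unfolding distr_Y by (subst emeasure_density) (auto intro!: nn_integral_cong)
  also have "\<dots> = 1"
    using prob_space.emeasure_space_1[OF prob_space_distr[OF Y]] by simp
  finally show "(\<integral>\<^sup>+w. ennreal (marginal (Y w) / k (X w) (Y w)) \<partial>M) = ennreal 1"
    by (simp add: emeasure_space_1)
qed (use k_pos marginal_pos measurable_space[OF Y] in \<open>auto simp: less_imp_le intro!: AE_I2\<close>)

text \<open>This is \<open>ln u \<le> u - 1\<close> at the inverse ratio \<open>u\<close>.\<close>

lemma log_ratio_ge:
  assumes "w \<in> space M"
  shows "1 - marginal (Y w) / k (X w) (Y w) \<le> ln (k (X w) (Y w)) - ln (marginal (Y w))"
  using k_pos[of "X w" "Y w"] marginal_pos[OF measurable_space[OF Y assms]]
    ln_le_minus_one[of "marginal (Y w) / k (X w) (Y w)"]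
  by (simp add: ln_div)

text \<open>Gibbs' inequality: the lower bound \<open>1 - marginal / k\<close> has expectation 0.
  The sign matters because \<open>ennreal\<close> truncates negative numbers and is additive only on
  nonnegative ones.\<close>

lemma log_ratio_expectation_nonneg:
  assumes "integrable M (\<lambda>w. ln (k (X w) (Y w)) - ln (marginal (Y w)))"
  shows "0 \<le> (\<integral>w. ln (k (X w) (Y w)) - ln (marginal (Y w)) \<partial>M)"
proof -
  note ratio = has_bochner_integral_inverse_ratio[unfolded has_bochner_integral_iff]
  have "0 = (\<integral>w. 1 - marginal (Y w) / k (X w) (Y w) \<partial>M)"
    using ratio by (simp add: prob_space)
  also have "\<dots> \<le> (\<integral>w. ln (k (X w) (Y w)) - ln (marginal (Y w)) \<partial>M)"
    using ratio assms log_ratio_ge by (intro integral_mono) auto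
  finally show ?thesis .
qed

end

section \<open>Conditional laws\<close>

text \<open>The Borel sets have a countable generator closed under intersection, so the null sets of
  the individual equalities unite to one null set, outside of which the two measures agree by the
  uniqueness theorem for generators.\<close>

lemma AE_measure_eq_borel:
  fixes K K' :: "'c \<Rightarrow> 'a::second_countable_topology measure"
  assumes sets: "\<And>z. z \<in> space D \<Longrightarrow> sets (K z) = sets borel"
      "\<And>z. z \<in> space D \<Longrightarrow> sets (K' z) = sets borel"
    and fin: "\<And>z. z \<in> space D \<Longrightarrow> finite_measure (K z)"
    and eq: "\<And>B. B \<in> sets borel \<Longrightarrow> AE z in D. emeasure (K z) B = emeasure (K' z) B"
  shows "AE z in D. K z = K' z"
proof -
  obtain B :: "'a set set" where B: "countable B" "topological_basis B"
    using ex_countable_basis by blast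
  \<comment> \<open>Finite intersections make the base stable under intersection and keep it
    countable; the empty family contributes \<open>UNIV\<close>, which serves as the exhausting
    sequence.\<close>
  define E where "E = Inter ` {F. finite F \<and> F \<subseteq> B}"
  have E_count: "countable E"
    unfolding E_def using countable_Collect_finite_subset[OF B(1)] by auto
  have E_open: "open X" if "X \<in> E" for X
    using that topological_basis_open[OF B(2)] unfolding E_def by (auto intro!: open_Inter)
  have "B \<subseteq> E"
  proof
    fix b assume "b \<in> B"
    then have "b = Inter {b} \<and> finite {b} \<and> {b} \<subseteq> B" by simp
    then show "b \<in> E" unfolding E_def by blast
  qed
  have UNIV_E: "UNIV \<in> E"
    unfolding E_def by (auto intro!: image_eqI[where x="{}"])
  have borel_E: "sets (borel :: 'a measure) = sigma_sets UNIV E"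
  proof
    show "sets (borel :: 'a measure) \<subseteq> sigma_sets UNIV E"
      by (subst borel_eq_countable_basis[OF B]) (simp add: sigma_sets_mono'[OF \<open>B \<subseteq> E\<close>])
    show "sigma_sets UNIV E \<subseteq> sets (borel :: 'a measure)"
      using sets.sigma_sets_subset[of E borel] E_open by (auto simp: subset_eq)
  qed
  have Int: "Int_stable E"
    unfolding E_def Int_stable_def
    by (auto simp: Inter_Un_distrib[symmetric] intro!: imageI)
  have "AE z in D. \<forall>X\<in>E. emeasure (K z) X = emeasure (K' z) X"
    by (subst AE_ball_countable[OF E_count]) (use eq E_open in auto)
  then show ?thesis
    using AE_space
  proof eventually_elim
    case (elim z)
    interpret finite_measure "K z" using elim fin by simp
    show "K z = K' z"
      by (rule measure_eqI_generator_eq[OF Int, where \<Omega>=UNIV and A="\<lambda>_. UNIV"])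
         (use elim sets[of z] borel_E UNIV_E emeasure_finite in auto)
  qed
qed

text \<open>For fixed \<open>B\<close>, both \<open>emeasure (K z) B\<close> and
  \<open>emeasure (K' z) B\<close> are densities of the measure that gives \<open>A\<close> the
  probability of \<open>Z\<close> in \<open>A\<close> and \<open>X\<close> in \<open>B\<close>, so
  they agree almost everywhere.\<close>

lemma is_cond_law_unique:
  fixes K K' :: "'c \<Rightarrow> 'a::second_countable_topology measure"
  assumes "finite_measure M" and Z[measurable]: "Z \<in> M \<rightarrow>\<^sub>M U" and S: "sets S = sets borel"
    and K: "is_cond_law M S U X Z K" and K': "is_cond_law M S U X Z K'"
  shows "AE z in distr M U Z. K z = K' z"
proof (rule AE_measure_eq_borel)
  interpret finite_measure M by fact
  interpret D: finite_measure "distr M U Z" by (rule finite_measure_distr) simp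
  have [measurable]: "K \<in> U \<rightarrow>\<^sub>M subprob_algebra S" "K' \<in> U \<rightarrow>\<^sub>M subprob_algebra S"
    using K K' by (auto simp: is_cond_law_def)
  fix B :: "'a set" assume "B \<in> sets borel"
  then have B[measurable]: "B \<in> sets S" by (simp add: S)
  show "AE z in distr M U Z. emeasure (K z) B = emeasure (K' z) B"
  proof (rule D.density_unique)
    show "density (distr M U Z) (\<lambda>z. emeasure (K z) B) = density (distr M U Z) (\<lambda>z. emeasure (K' z) B)"
    proof (rule measure_eqI)
      fix A assume "A \<in> sets (density (distr M U Z) (\<lambda>z. emeasure (K z) B))"
      then have "A \<in> sets U" by simp
      then show "emeasure (density (distr M U Z) (\<lambda>z. emeasure (K z) B)) A
          = emeasure (density (distr M U Z) (\<lambda>z. emeasure (K' z) B)) A"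
        using K K' B by (simp add: emeasure_density is_cond_law_def mult.commute)
    qed simp
  qed measurable
qed (use K K' in \<open>auto simp: is_cond_law_def S dest!: measurable_space
      intro: subprob_space.axioms dest: sets_kernel simp: space_subprob_algebra
      subprob_space_def\<close>)

text \<open>The defining identity of a conditional law is equality of the two measures on
  rectangles, which form an intersection-stable generator. \<open>S\<close> and \<open>N\<close>
  share only their measurable sets: \<open>N\<close> carries the reference measure, such as
  \<open>lborel\<close> over \<open>borel\<close>.\<close>

lemma is_cond_law_density_joint:
  assumes "prob_space M" and "sigma_finite_measure N"
    and Z[measurable]: "Z \<in> M \<rightarrow>\<^sub>M U" and X[measurable]: "X \<in> M \<rightarrow>\<^sub>M S"
    and N: "sets N = sets S"
    and k[measurable]: "(\<lambda>(z, x). k z x) \<in> borel_measurable (U \<Otimes>\<^sub>M N)"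
    and K: "is_cond_law M S U X Z (\<lambda>z. density N (k z))"
  shows "distr M (U \<Otimes>\<^sub>M S) (\<lambda>w. (Z w, X w)) = density (distr M U Z \<Otimes>\<^sub>M N) (\<lambda>(z, x). k z x)"
proof -
  interpret prob_space M by fact
  interpret N: sigma_finite_measure N by fact
  note N[measurable_cong]
  interpret J: prob_space "distr M (U \<Otimes>\<^sub>M S) (\<lambda>w. (Z w, X w))"
    by (rule prob_space_distr) measurable
  have space_N: "space N = space S" using sets_eq_imp_space_eq[OF N] .
  show ?thesis
  proof (rule measure_eqI_generator_eq[OF Int_stable_pair_measure_generator[of U S],
          where A="\<lambda>_. space U \<times> space S" and \<Omega>="space U \<times> space S"])
    fix C assume "C \<in> {a \<times> b |a b. a \<in> sets U \<and> b \<in> sets S}"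
    then obtain A B where C: "C = A \<times> B" and [measurable]: "A \<in> sets U" "B \<in> sets S" by auto
    have "emeasure (distr M (U \<Otimes>\<^sub>M S) (\<lambda>w. (Z w, X w))) C
        = emeasure M {w \<in> space M. Z w \<in> A \<and> X w \<in> B}"
      unfolding C by (subst emeasure_distr) (auto intro!: arg_cong2[where f=emeasure])
    also have "\<dots> = (\<integral>\<^sup>+z\<in>A. emeasure (density N (k z)) B \<partial>distr M U Z)"
      using K by (simp add: is_cond_law_def)
    also have "\<dots> = (\<integral>\<^sup>+z. \<integral>\<^sup>+x. k z x * indicator (A \<times> B) (z, x) \<partial>N \<partial>distr M U Z)"
      by (rule nn_integral_cong)
         (auto simp: emeasure_density indicator_def)
    also have "\<dots> = emeasure (density (distr M U Z \<Otimes>\<^sub>M N) (\<lambda>(z, x). k z x)) C"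
      using N.nn_integral_fst[of "\<lambda>z. case_prod k z * indicator (A \<times> B) z" "distr M U Z"]
      unfolding C by (subst emeasure_density) (auto simp: split_beta')
    finally show "emeasure (distr M (U \<Otimes>\<^sub>M S) (\<lambda>w. (Z w, X w))) C
        = emeasure (density (distr M U Z \<Otimes>\<^sub>M N) (\<lambda>(z, x). k z x)) C" .
  qed (auto simp: sets_pair_measure space_N N J.emeasure_finite dest: sets.sets_into_space)
qed

lemma joint_densityI:
  fixes k :: "'a \<Rightarrow> 'b \<Rightarrow> real"
  assumes "prob_space M" and "sigma_finite_measure N"
    and "X \<in> M \<rightarrow>\<^sub>M S" and "Y \<in> M \<rightarrow>\<^sub>M N"
    and k: "(\<lambda>(x, y). k x y) \<in> borel_measurable (S \<Otimes>\<^sub>M N)"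
    and "\<And>x y. 0 < k x y" and "\<And>x y. k x y \<le> C"
    and K: "is_cond_law M N S Y X (\<lambda>x. density N (\<lambda>y. ennreal (k x y)))"
  shows "joint_density M S N X Y k"
proof -
  interpret prob_space M by fact
  interpret N: sigma_finite_measure N by fact
  show ?thesis
  proof
    show "distr M (S \<Otimes>\<^sub>M N) (\<lambda>w. (X w, Y w))
        = density (distr M S X \<Otimes>\<^sub>M N) (\<lambda>(x, y). ennreal (k x y))"
      by (rule is_cond_law_density_joint[OF assms(1-4) refl _ K]) (use k in measurable)
  qed (use assms in auto)
qed

section \<open>Gaussian densities and kernels\<close>

text \<open>Only the measurable sets of the target spaces enter, so \<open>borel\<close> may be
  exchanged for \<open>lborel\<close>, the reference measure of the densities.\<close>

lemma mutual_info_cong_sets: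
  assumes "sets S = sets S'" and "sets T = sets T'"
  shows "mutual_info M S T X Y = mutual_info M S' T' X Y"
proof -
  have "distr M S X = distr M S' X" "distr M T Y = distr M T' Y"
    using assms by (auto intro!: distr_cong)
  moreover have "distr M (S \<Otimes>\<^sub>M T) (\<lambda>w. (X w, Y w)) = distr M (S' \<Otimes>\<^sub>M T') (\<lambda>w. (X w, Y w))"
    using assms by (auto intro!: distr_cong sets_pair_measure_cong)
  ultimately show ?thesis
    by (simp add: mutual_info_def)
qed

lemma borel_measurable_normal_density_raw[measurable (raw)]:
  assumes [measurable]: "f \<in> borel_measurable M" "g \<in> borel_measurable M" "h \<in> borel_measurable M"
  shows "(\<lambda>x. normal_density (f x) (g x) (h x)) \<in> borel_measurable M"
  unfolding normal_density_def by measurable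

lemma normal_density_le: "normal_density m s x \<le> 1 / sqrt (2 * pi * s\<^sup>2)"
  unfolding normal_density_def by (auto intro!: divide_right_mono)

text \<open>The bound does not depend on \<open>u\<close>, which gives the densities of
  \<open>Y\<close> given \<open>L\<close> one common bound.\<close>

lemma normal_density_sqrt_add_le:
  assumes "0 < v" "0 \<le> u"
  shows "normal_density m (sqrt (u + v)) x \<le> 1 / sqrt (2 * pi * v)"
proof -
  have "normal_density m (sqrt (u + v)) x \<le> 1 / sqrt (2 * pi * (u + v))"
    using normal_density_le[of m "sqrt (u + v)" x] assms by simp
  also have "\<dots> \<le> 1 / sqrt (2 * pi * v)"
    using assms by (intro divide_left_mono) auto
  finally show ?thesis .
qed

lemma nn_integral_normal_density:
  assumes "0 < s"
  shows "(\<integral>\<^sup>+x. ennreal (normal_density m s x) \<partial>lborel) = 1"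
  using assms by (subst nn_integral_eq_integral) auto

lemma nn_integral_normal_standardized_square:
  assumes s: "0 < s"
  shows "(\<integral>\<^sup>+x. ennreal (normal_density m s x) * ennreal (((x - m) / s)\<^sup>2) \<partial>lborel) = 1"
proof -
  have "has_bochner_integral lborel (\<lambda>x. normal_density m s x * (x - m) ^ (2 * 1)) (s\<^sup>2)"
    using normal_moment_even[OF s, of m 1] by simp
  then have "has_bochner_integral lborel (\<lambda>x. normal_density m s x * (x - m)\<^sup>2 / s\<^sup>2) (s\<^sup>2 / s\<^sup>2)"
    by (intro has_bochner_integral_divide_zero) simp
  then have "has_bochner_integral lborel (\<lambda>x. normal_density m s x * ((x - m) / s)\<^sup>2) 1"
    using s by (simp add: power_divide)
  then show ?thesis
    by (subst ennreal_mult[symmetric])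
       (auto simp: has_bochner_integral_iff nn_integral_eq_integral)
qed

text \<open>By translation the integrand is that of a convolution of two centred normal densities,
  whose variances add.\<close>

lemma nn_integral_normal_mixture:
  assumes l: "l \<noteq> 0" and v: "0 < v"
  shows "(\<integral>\<^sup>+t. ennreal (normal_density 0 (sqrt (l\<^sup>2)) t) * ennreal (normal_density t (sqrt v) y) \<partial>lborel)
    = ennreal (normal_density 0 (sqrt (l\<^sup>2 + v)) y)"
proof -
  have "(\<integral>\<^sup>+t. ennreal (normal_density 0 (sqrt (l\<^sup>2)) t) * ennreal (normal_density t (sqrt v) y) \<partial>lborel)
     = (\<integral>\<^sup>+t. ennreal (normal_density 0 (sqrt v) (y - t) * normal_density 0 \<bar>l\<bar> t) \<partial>lborel)"
    by (intro nn_integral_cong) (simp add: ennreal_mult[symmetric] normal_density_def mult.commute)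
  also have "\<dots> = ennreal (normal_density 0 (sqrt ((sqrt v)\<^sup>2 + \<bar>l\<bar>\<^sup>2)) y)"
    using conv_normal_density_zero_mean[of "sqrt v" "\<bar>l\<bar>"] l v by (simp add: fun_eq_iff)
  finally show ?thesis
    using v by (simp add: add.commute)
qed

section \<open>Gaussian laws as kernels\<close>

lemma sets_gaussian[simp, measurable_cong]: "sets (gaussian m v) = sets borel"
  by (simp add: gaussian_def)

lemma space_gaussian[simp]: "space (gaussian m v) = UNIV"
  by (simp add: gaussian_def)

lemma nn_integral_gaussian:
  "f \<in> borel_measurable borel \<Longrightarrow>
     (\<integral>\<^sup>+x. f x \<partial>gaussian m v) = (\<integral>\<^sup>+x. ennreal (normal_density m (sqrt v) x) * f x \<partial>lborel)"
  unfolding gaussian_def by (subst nn_integral_density) auto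

text \<open>For negative \<open>v\<close> the value \<open>sqrt v\<close> is negative, but the
  density depends only on its square, so its absolute value serves as standard deviation.\<close>

lemma prob_space_gaussian: "v \<noteq> 0 \<Longrightarrow> prob_space (gaussian m v)"
proof -
  assume "v \<noteq> 0"
  moreover have "normal_density m (sqrt v) x = normal_density m \<bar>sqrt v\<bar> x" for x
    by (simp add: normal_density_def)
  ultimately show ?thesis
    unfolding gaussian_def using prob_space_normal_density[of "\<bar>sqrt v\<bar>" m] by simp
qed

text \<open>At \<open>v = 0\<close> division by zero makes the density 0, and
  \<open>gaussian m 0\<close> is the null measure rather than a point mass. Covering all parameters
  makes \<open>gaussian\<close> a kernel on the whole line.\<close>

lemma subprob_space_gaussian: "subprob_space (gaussian m v)"
proof (cases "v = 0")
  case True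
  then show ?thesis
    by (intro subprob_spaceI) (auto simp: gaussian_def normal_density_def emeasure_density)
qed (simp add: prob_space_gaussian prob_space_imp_subprob_space)

lemma measurable_gaussian[measurable (raw)]:
  assumes [measurable]: "m \<in> borel_measurable N" "v \<in> borel_measurable N"
  shows "(\<lambda>z. gaussian (m z) (v z)) \<in> N \<rightarrow>\<^sub>M subprob_algebra borel"
proof (rule measurable_subprob_algebra)
  fix A :: "real set" assume [measurable]: "A \<in> sets borel"
  show "(\<lambda>z. emeasure (gaussian (m z) (v z)) A) \<in> borel_measurable N"
    unfolding gaussian_def by (subst emeasure_density) auto
qed (auto simp: subprob_space_gaussian)

lemma emeasure_gaussian_mixture:
  assumes l: "l \<noteq> 0" and v: "0 < v" and B[measurable]: "B \<in> sets borel"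
  shows "(\<integral>\<^sup>+t. emeasure (gaussian t v) B \<partial>gaussian 0 (l\<^sup>2)) = emeasure (gaussian 0 (l\<^sup>2 + v)) B"
proof -
  have meas: "(\<lambda>t. emeasure (gaussian t v) B) \<in> borel_measurable borel"
    by (rule measurable_emeasure_kernel[OF measurable_gaussian B]) auto
  have "(\<integral>\<^sup>+t. emeasure (gaussian t v) B \<partial>gaussian 0 (l\<^sup>2))
    = (\<integral>\<^sup>+t. \<integral>\<^sup>+y. ennreal (normal_density 0 (sqrt (l\<^sup>2)) t)
          * (ennreal (normal_density t (sqrt v) y) * indicator B y) \<partial>lborel \<partial>lborel)"
    by (subst nn_integral_gaussian[OF meas])
       (simp add: nn_integral_cmult gaussian_def emeasure_density)
  also have "\<dots> = (\<integral>\<^sup>+y. \<integral>\<^sup>+t. ennreal (normal_density 0 (sqrt (l\<^sup>2)) t)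
          * (ennreal (normal_density t (sqrt v) y) * indicator B y) \<partial>lborel \<partial>lborel)"
    by (rule lborel_pair.Fubini') measurable
  also have "\<dots> = (\<integral>\<^sup>+y. ennreal (normal_density 0 (sqrt (l\<^sup>2 + v)) y) * indicator B y \<partial>lborel)"
    by (intro nn_integral_cong)
       (simp add: mult.assoc[symmetric] nn_integral_multc nn_integral_normal_mixture[OF l v, simplified])
  finally show ?thesis
    by (simp add: gaussian_def emeasure_density)
qed

text \<open>Up to a constant, the log density is minus half the log variance minus half the
  standardized square; the log variances differ by \<open>ln (1 + l\<^sup>2 / v)\<close>.\<close>

lemma ln_normal_density_ratio:
  assumes v: "0 < v"
  shows "ln (normal_density t (sqrt v) y) - ln (normal_density 0 (sqrt (l\<^sup>2 + v)) y)
     = ln (1 + l\<^sup>2 / v) / 2 - ((y - t) / sqrt v)\<^sup>2 / 2 + (y / sqrt (l\<^sup>2 + v))\<^sup>2 / 2"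
proof -
  have w: "0 < l\<^sup>2 + v" using v by (simp add: add_nonneg_pos)
  have ln_nd: "ln (normal_density m (sqrt u) x) = - ln (2 * pi) / 2 - ln u / 2 - ((x - m) / sqrt u)\<^sup>2 / 2"
    if "0 < u" for m u x :: real
    using that by (simp add: normal_density_def ln_mult ln_div ln_sqrt power_divide add_divide_distrib algebra_simps)
  have "1 + l\<^sup>2 / v = (l\<^sup>2 + v) / v" using v by (simp add: field_simps)
  then have "ln (1 + l\<^sup>2 / v) = ln (l\<^sup>2 + v) - ln v"
    using v w by (simp add: ln_div)
  then show ?thesis
    unfolding ln_nd[OF v] ln_nd[OF w] diff_0_right by linarith
qed

text \<open>Given \<open>X\<close>, the standardized variable has second moment 1, and averaging
  over \<open>X\<close> keeps this value.\<close>

lemma has_bochner_integral_standardized_square: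
  assumes J: "joint_density M S lborel X Y (\<lambda>x y. normal_density (m x) (s x) y)"
    and m[measurable]: "m \<in> borel_measurable S" and s[measurable]: "s \<in> borel_measurable S"
    and pos: "\<And>x. 0 < s x"
  shows "has_bochner_integral M (\<lambda>w. ((Y w - m (X w)) / s (X w))\<^sup>2) 1"
proof (rule has_bochner_integral_nn_integral)
  interpret joint_density M S lborel X Y "\<lambda>x y. normal_density (m x) (s x) y" by fact
  have [measurable]: "Y \<in> borel_measurable M"
    using Y by simp
  show "(\<lambda>w. ((Y w - m (X w)) / s (X w))\<^sup>2) \<in> borel_measurable M"
    by measurable
  show "(\<integral>\<^sup>+w. ennreal (((Y w - m (X w)) / s (X w))\<^sup>2) \<partial>M) = ennreal 1"
    using nn_integral_joint[of "\<lambda>(x, y). ennreal (((y - m x) / s x)\<^sup>2)"] pos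
    by (simp add: nn_integral_normal_standardized_square emeasure_space_1)
qed simp_all

text \<open>The intended conditional law of signal and observation given the scale, with
  \<open>u\<close> the squared scale. Writing it as a density over
  \<open>gaussian 0 u \<Otimes>\<^sub>M lborel\<close> puts it into the form of
  \<open>joint_density\<close>.\<close>

definition gaussian_pair :: "real \<Rightarrow> real \<Rightarrow> (real \<times> real) measure" where
  "gaussian_pair u v =
     density (gaussian 0 u \<Otimes>\<^sub>M lborel) (\<lambda>(t, y). ennreal (normal_density t (sqrt v) y))"

lemma sets_gaussian_pair[simp, measurable_cong]:
  "sets (gaussian_pair u v) = sets (borel \<Otimes>\<^sub>M borel)"
  unfolding gaussian_pair_def by (auto intro!: sets_pair_measure_cong)

lemma space_gaussian_pair[simp]: "space (gaussian_pair u v) = UNIV"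
  by (simp add: gaussian_pair_def space_pair_measure)

lemma nn_integral_gaussian_pair:
  assumes [measurable]: "f \<in> borel_measurable (borel \<Otimes>\<^sub>M borel)"
  shows "(\<integral>\<^sup>+z. f z \<partial>gaussian_pair u v)
    = (\<integral>\<^sup>+t. \<integral>\<^sup>+y. ennreal (normal_density t (sqrt v) y) * f (t, y) \<partial>lborel \<partial>gaussian 0 u)"
  unfolding gaussian_pair_def
  apply (subst nn_integral_density)
    apply measurable
  apply (subst lborel.nn_integral_fst[symmetric])
   apply (auto simp: split_beta')
  done

lemma distr_gaussian_pair_fst:
  assumes v: "0 < v"
  shows "distr (gaussian_pair u v) borel fst = gaussian 0 u"
proof (rule measure_eqI)
  fix A assume "A \<in> sets (distr (gaussian_pair u v) borel fst)"
  then have A[measurable]: "A \<in> sets borel" by simp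
  have "emeasure (distr (gaussian_pair u v) borel fst) A
      = (\<integral>\<^sup>+z. indicator A z \<partial>distr (gaussian_pair u v) borel fst)"
    by simp
  also have "\<dots> = (\<integral>\<^sup>+z. indicator A (fst z) \<partial>gaussian_pair u v)"
    by (rule nn_integral_distr) auto
  also have "\<dots> = (\<integral>\<^sup>+t. indicator A t \<partial>gaussian 0 u)"
    using v by (simp add: nn_integral_gaussian_pair nn_integral_multc nn_integral_normal_density)
  finally show "emeasure (distr (gaussian_pair u v) borel fst) A = emeasure (gaussian 0 u) A"
    by simp
qed simp

lemma emeasure_space_gaussian_pair:
  assumes "0 < v"
  shows "emeasure (gaussian_pair u v) UNIV = emeasure (gaussian 0 u) UNIV"
  unfolding distr_gaussian_pair_fst[OF assms, symmetric] by (subst emeasure_distr) auto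

lemma measurable_gaussian_pair[measurable (raw)]:
  assumes [measurable]: "u \<in> borel_measurable N" and v: "0 < v"
  shows "(\<lambda>z. gaussian_pair (u z) v) \<in> N \<rightarrow>\<^sub>M subprob_algebra (borel \<Otimes>\<^sub>M borel)"
proof (rule measurable_subprob_algebra)
  fix A :: "(real \<times> real) set" assume A[measurable]: "A \<in> sets (borel \<Otimes>\<^sub>M borel)"
  have "emeasure (gaussian_pair (u z) v) A
      = (\<integral>\<^sup>+t. \<integral>\<^sup>+y. ennreal (normal_density t (sqrt v) y) * indicator A (t, y) \<partial>lborel
          \<partial>gaussian 0 (u z))" for z
    using nn_integral_gaussian_pair[of "indicator A" "u z" v] by simp
  then show "(\<lambda>z. emeasure (gaussian_pair (u z) v) A) \<in> borel_measurable N"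
    by (simp add: nn_integral_gaussian)
next
  fix z
  show "subprob_space (gaussian_pair (u z) v)"
    by (intro subprob_spaceI)
       (use subprob_space.emeasure_space_le_1[OF subprob_space_gaussian] v in
         \<open>auto simp: emeasure_space_gaussian_pair\<close>)
qed simp

lemma joint_density_gaussian_pair:
  assumes u: "0 < u" and v: "0 < v"
  shows "joint_density (gaussian_pair u v) borel lborel fst snd (\<lambda>t y. normal_density t (sqrt v) y)"
proof -
  interpret G: prob_space "gaussian 0 u" by (rule prob_space_gaussian) (use u in simp)
  interpret prob_space "gaussian_pair u v"
    by (rule prob_spaceI) (use G.emeasure_space_1 v in \<open>simp add: emeasure_space_gaussian_pair\<close>)
  show ?thesis
  proof
    have "distr (gaussian_pair u v) (borel \<Otimes>\<^sub>M lborel) (\<lambda>w. (fst w, snd w)) = gaussian_pair u v"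
      unfolding prod.collapse by (rule distr_id2) (auto intro!: sets_pair_measure_cong)
    also have "\<dots> = density (gaussian 0 u \<Otimes>\<^sub>M lborel) (\<lambda>(x, y). ennreal (normal_density x (sqrt v) y))"
      by (simp add: gaussian_pair_def)
    finally show "distr (gaussian_pair u v) (borel \<Otimes>\<^sub>M lborel) (\<lambda>w. (fst w, snd w))
      = density (distr (gaussian_pair u v) borel fst \<Otimes>\<^sub>M lborel)
          (\<lambda>(x, y). ennreal (normal_density x (sqrt v) y))"
      by (simp only: distr_gaussian_pair_fst[OF v])
    show "\<exists>C. \<forall>x y. normal_density x (sqrt v) y \<le> C"
      using normal_density_le by blast
  qed (use v in \<open>auto simp: normal_density_pos\<close>)
qed

text \<open>The second coordinate has law N(0, \<open>l\<^sup>2 + v\<close>). The log ratio is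
  therefore the claimed constant plus half the difference of two standardized squares, each of
  expectation 1.\<close>

lemma mutual_info_gaussian_pair:
  assumes l: "l \<noteq> 0" and v: "0 < v"
  shows "mutual_info (gaussian_pair (l\<^sup>2) v) borel borel fst snd = ennreal (ln (1 + l\<^sup>2 / v) / 2)"
proof -
  have l2: "0 < l\<^sup>2" using l by simp
  have w: "0 < l\<^sup>2 + v" using l2 v by (rule add_pos_pos)
  interpret joint_density "gaussian_pair (l\<^sup>2) v" borel lborel fst snd "\<lambda>t y. normal_density t (sqrt v) y"
    by (rule joint_density_gaussian_pair[OF l2 v])
  let ?P = "gaussian_pair (l\<^sup>2) v"
  let ?b = "\<lambda>z. ln (normal_density (fst z) (sqrt v) (snd z)) - ln (marginal (snd z))"
  have marginal: "marginal y = normal_density 0 (sqrt (l\<^sup>2 + v)) y" for y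
  proof -
    have "ennreal (marginal y) = (\<integral>\<^sup>+t. ennreal (normal_density t (sqrt v) y) \<partial>distr ?P borel fst)"
      by (subst nn_integral_distr) (auto simp: ennreal_marginal)
    also have "\<dots> = ennreal (normal_density 0 (sqrt (l\<^sup>2 + v)) y)"
      using nn_integral_normal_mixture[OF l v, of y]
      by (simp add: distr_gaussian_pair_fst[OF v] nn_integral_gaussian)
    finally show ?thesis
      using marginal_pos[of y] by (simp add: less_imp_le)
  qed
  have 1: "has_bochner_integral ?P (\<lambda>z. ((snd z - fst z) / sqrt v)\<^sup>2) 1"
    by (rule has_bochner_integral_standardized_square[OF joint_density_axioms]) (use v in auto)
  \<comment> \<open>This square involves only the second coordinate, so its mean is computed from
    the marginal law.\<close>
  have 2: "has_bochner_integral ?P (\<lambda>z. (snd z / sqrt (l\<^sup>2 + v))\<^sup>2) 1"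
  proof (rule has_bochner_integral_nn_integral)
    have "(\<integral>\<^sup>+z. ennreal ((snd z / sqrt (l\<^sup>2 + v))\<^sup>2) \<partial>?P)
        = (\<integral>\<^sup>+y. ennreal ((y / sqrt (l\<^sup>2 + v))\<^sup>2) \<partial>distr ?P lborel snd)"
      by (subst nn_integral_distr) auto
    also have "\<dots> = 1"
      unfolding distr_Y marginal
      using nn_integral_normal_standardized_square[of "sqrt (l\<^sup>2 + v)" 0] w
      by (subst nn_integral_density) auto
    finally show "(\<integral>\<^sup>+z. ennreal ((snd z / sqrt (l\<^sup>2 + v))\<^sup>2) \<partial>?P) = ennreal 1" by simp
  qed auto
  have "has_bochner_integral ?P
      (\<lambda>z. ln (1 + l\<^sup>2 / v) / 2 - ((snd z - fst z) / sqrt v)\<^sup>2 / 2 + (snd z / sqrt (l\<^sup>2 + v))\<^sup>2 / 2)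
      (ln (1 + l\<^sup>2 / v) / 2 - 1 / 2 + 1 / 2)"
    by (intro has_bochner_integral_add has_bochner_integral_diff has_bochner_integral_divide_zero 1 2)
       (use prob_space in \<open>simp_all add: has_bochner_integral_iff\<close>)
  then have "has_bochner_integral ?P ?b (ln (1 + l\<^sup>2 / v) / 2)"
    by (simp add: marginal ln_normal_density_ratio[OF v])
  moreover have "mutual_info ?P borel borel fst snd = mutual_info ?P borel lborel fst snd"
    by (rule mutual_info_cong_sets) auto
  ultimately show ?thesis
    by (simp only: mutual_info_eq has_bochner_integral_iff if_True)
qed

section \<open>The scale mixture model\<close>

text \<open>The noise variance is the single parameter \<open>v\<close>. The Markov property is
  contained in \<open>cond_Y\<close>: the kernel is conditioned on both \<open>L\<close> and
  \<open>\<theta>\<close> but ignores the first coordinate.\<close>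

locale gaussian_scale_mixture = prob_space M
  for M :: "'w measure" and L \<theta> Y :: "'w \<Rightarrow> real" and v :: real +
  assumes v: "0 < v"
    and L[measurable]: "L \<in> borel_measurable M"
    and \<theta>[measurable]: "\<theta> \<in> borel_measurable M"
    and Y[measurable]: "Y \<in> borel_measurable M"
    and L_pos: "AE w in M. L w > 0"
    and cond_\<theta>: "is_cond_law M borel borel \<theta> L (\<lambda>l. gaussian 0 (l\<^sup>2))"
    and cond_Y: "is_cond_law M borel (borel \<Otimes>\<^sub>M borel) Y (\<lambda>w. (L w, \<theta> w)) (\<lambda>(l, t). gaussian t v)"
begin

section \<open>Integration along the chain and its conditional laws\<close>

lemma nn_integral_L_\<theta>:
  assumes g[measurable]: "g \<in> borel_measurable (borel \<Otimes>\<^sub>M borel)"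
  shows "(\<integral>\<^sup>+w. g (L w, \<theta> w) \<partial>M) = (\<integral>\<^sup>+w. \<integral>\<^sup>+t. g (L w, t) \<partial>gaussian 0 ((L w)\<^sup>2) \<partial>M)"
proof -
  let ?k = "\<lambda>l t. ennreal (normal_density 0 (sqrt (l\<^sup>2)) t)"
  have "(\<integral>\<^sup>+w. g (L w, \<theta> w) \<partial>M) = (\<integral>\<^sup>+z. g z \<partial>distr M (borel \<Otimes>\<^sub>M borel) (\<lambda>w. (L w, \<theta> w)))"
    by (subst nn_integral_distr) auto
  also have "distr M (borel \<Otimes>\<^sub>M borel) (\<lambda>w. (L w, \<theta> w))
      = density (distr M borel L \<Otimes>\<^sub>M lborel) (\<lambda>(l, t). ?k l t)"
    by (rule is_cond_law_density_joint)
       (use cond_\<theta> prob_space_axioms lborel.sigma_finite_measure_axioms in \<open>auto simp: gaussian_def\<close>)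
  also have "(\<integral>\<^sup>+z. g z \<partial>\<dots>) = (\<integral>\<^sup>+l. \<integral>\<^sup>+t. ?k l t * g (l, t) \<partial>lborel \<partial>distr M borel L)"
    using lborel.nn_integral_fst[of "\<lambda>z. case_prod ?k z * g z" "distr M borel L"]
    by (subst nn_integral_density) (auto simp: split_beta')
  also have "\<dots> = (\<integral>\<^sup>+w. \<integral>\<^sup>+t. ?k (L w) t * g (L w, t) \<partial>lborel \<partial>M)"
    by (subst nn_integral_distr) auto
  also have "\<dots> = (\<integral>\<^sup>+w. \<integral>\<^sup>+t. g (L w, t) \<partial>gaussian 0 ((L w)\<^sup>2) \<partial>M)"
    by (intro nn_integral_cong) (simp add: nn_integral_gaussian)
  finally show ?thesis .
qed

lemma nn_integral_L_\<theta>_Y: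
  assumes g[measurable]: "g \<in> borel_measurable ((borel \<Otimes>\<^sub>M borel) \<Otimes>\<^sub>M borel)"
  shows "(\<integral>\<^sup>+w. g ((L w, \<theta> w), Y w) \<partial>M)
     = (\<integral>\<^sup>+w. \<integral>\<^sup>+y. ennreal (normal_density (\<theta> w) (sqrt v) y) * g ((L w, \<theta> w), y) \<partial>lborel \<partial>M)"
proof -
  let ?D = "distr M (borel \<Otimes>\<^sub>M borel) (\<lambda>w. (L w, \<theta> w))"
  let ?k = "\<lambda>z y. ennreal (normal_density (snd z) (sqrt v) y)"
  have "(\<integral>\<^sup>+w. g ((L w, \<theta> w), Y w) \<partial>M)
      = (\<integral>\<^sup>+z. g z \<partial>distr M ((borel \<Otimes>\<^sub>M borel) \<Otimes>\<^sub>M borel) (\<lambda>w. ((L w, \<theta> w), Y w)))"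
    by (subst nn_integral_distr) auto
  also have "distr M ((borel \<Otimes>\<^sub>M borel) \<Otimes>\<^sub>M borel) (\<lambda>w. ((L w, \<theta> w), Y w))
      = density (?D \<Otimes>\<^sub>M lborel) (\<lambda>(z, y). ?k z y)"
    by (rule is_cond_law_density_joint)
       (use cond_Y prob_space_axioms lborel.sigma_finite_measure_axioms
         in \<open>auto simp: gaussian_def split_beta'\<close>)
  also have "(\<integral>\<^sup>+z. g z \<partial>\<dots>) = (\<integral>\<^sup>+z. \<integral>\<^sup>+y. ?k z y * g (z, y) \<partial>lborel \<partial>?D)"
    using lborel.nn_integral_fst[of "\<lambda>z. case_prod ?k z * g z" ?D]
    by (subst nn_integral_density) (auto simp: split_beta')
  also have "\<dots> = (\<integral>\<^sup>+w. \<integral>\<^sup>+y. ?k (L w, \<theta> w) y * g ((L w, \<theta> w), y) \<partial>lborel \<partial>M)"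
    by (subst nn_integral_distr) auto
  finally show ?thesis by simp
qed

text \<open>Taking for \<open>A\<close> a cylinder over either coordinate gives the starting point
  for the law of \<open>Y\<close> given \<open>\<theta>\<close> alone and given \<open>L\<close>
  alone.\<close>

lemma emeasure_L_\<theta>_Y:
  assumes A[measurable]: "A \<in> sets (borel \<Otimes>\<^sub>M borel)" and B[measurable]: "B \<in> sets borel"
  shows "emeasure M {w \<in> space M. (L w, \<theta> w) \<in> A \<and> Y w \<in> B}
     = (\<integral>\<^sup>+w. emeasure (gaussian (\<theta> w) v) B * indicator A (L w, \<theta> w) \<partial>M)"
proof -
  have [measurable]: "(\<lambda>z. emeasure (gaussian (snd z) v) B) \<in> borel_measurable (borel \<Otimes>\<^sub>M borel)"
    by (rule measurable_emeasure_kernel[OF measurable_gaussian B]) auto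
  have "emeasure M {w \<in> space M. (L w, \<theta> w) \<in> A \<and> Y w \<in> B}
      = (\<integral>\<^sup>+z. emeasure (gaussian (snd z) v) B * indicator A z
          \<partial>distr M (borel \<Otimes>\<^sub>M borel) (\<lambda>w. (L w, \<theta> w)))"
    using cond_Y A B by (simp add: is_cond_law_def split_beta')
  also have "\<dots> = (\<integral>\<^sup>+w. emeasure (gaussian (\<theta> w) v) B * indicator A (L w, \<theta> w) \<partial>M)"
    by (subst nn_integral_distr) auto
  finally show ?thesis .
qed

text \<open>The kernel already depends on \<open>\<theta>\<close> only, so forgetting
  \<open>L\<close> leaves it unchanged.\<close>

lemma cond_Y_\<theta>: "is_cond_law M borel borel Y \<theta> (\<lambda>t. gaussian t v)"
  unfolding is_cond_law_def
proof (intro conjI ballI)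
  fix A B :: "real set" assume A[measurable]: "A \<in> sets borel" and B[measurable]: "B \<in> sets borel"
  have [measurable]: "(\<lambda>t. emeasure (gaussian t v) B) \<in> borel_measurable borel"
    by (rule measurable_emeasure_kernel[OF measurable_gaussian B]) auto
  have "emeasure M {w \<in> space M. \<theta> w \<in> A \<and> Y w \<in> B}
      = (\<integral>\<^sup>+w. emeasure (gaussian (\<theta> w) v) B * indicator A (\<theta> w) \<partial>M)"
    using emeasure_L_\<theta>_Y[of "UNIV \<times> A" B] by (simp add: indicator_def)
  also have "\<dots> = (\<integral>\<^sup>+t\<in>A. emeasure (gaussian t v) B \<partial>distr M borel \<theta>)"
    by (subst nn_integral_distr) auto
  finally show "emeasure M {w \<in> space M. \<theta> w \<in> A \<and> Y w \<in> B}
      = (\<integral>\<^sup>+t\<in>A. emeasure (gaussian t v) B \<partial>distr M borel \<theta>)" .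
qed (rule measurable_gaussian; simp)

text \<open>Averaging the kernel of \<open>Y\<close> over the conditional law of
  \<open>\<theta>\<close> is a Gaussian convolution.\<close>

lemma cond_Y_L: "is_cond_law M borel borel Y L (\<lambda>l. gaussian 0 (l\<^sup>2 + v))"
  unfolding is_cond_law_def
proof (intro conjI ballI)
  fix A B :: "real set" assume A[measurable]: "A \<in> sets borel" and B[measurable]: "B \<in> sets borel"
  have [measurable]: "(\<lambda>t. emeasure (gaussian t v) B) \<in> borel_measurable borel"
      "(\<lambda>l. emeasure (gaussian 0 (l\<^sup>2 + v)) B) \<in> borel_measurable borel"
    by (rule measurable_emeasure_kernel[OF measurable_gaussian B]; measurable)+
  have "emeasure M {w \<in> space M. L w \<in> A \<and> Y w \<in> B}
      = (\<integral>\<^sup>+w. emeasure (gaussian (\<theta> w) v) B * indicator A (L w) \<partial>M)"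
    using emeasure_L_\<theta>_Y[of "A \<times> UNIV" B] by (simp add: indicator_def)
  also have "\<dots> = (\<integral>\<^sup>+w. (\<integral>\<^sup>+t. emeasure (gaussian t v) B * indicator A (L w) \<partial>gaussian 0 ((L w)\<^sup>2)) \<partial>M)"
    using nn_integral_L_\<theta>[of "\<lambda>(l, t). emeasure (gaussian t v) B * indicator A l"] by simp
  \<comment> \<open>Almost sure positivity of \<open>L\<close> enters here: the mixture formula
    fails at scale 0, where \<open>gaussian 0 0\<close> is the null measure.\<close>
  also have "\<dots> = (\<integral>\<^sup>+w. emeasure (gaussian 0 ((L w)\<^sup>2 + v)) B * indicator A (L w) \<partial>M)"
    using L_pos
    by (intro nn_integral_cong_AE, eventually_elim)
       (simp add: nn_integral_multc emeasure_gaussian_mixture v)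
  also have "\<dots> = (\<integral>\<^sup>+l\<in>A. emeasure (gaussian 0 (l\<^sup>2 + v)) B \<partial>distr M borel L)"
    by (subst nn_integral_distr) auto
  finally show "emeasure M {w \<in> space M. L w \<in> A \<and> Y w \<in> B}
      = (\<integral>\<^sup>+l\<in>A. emeasure (gaussian 0 (l\<^sup>2 + v)) B \<partial>distr M borel L)" .
qed (rule measurable_gaussian; simp)

text \<open>Disintegrating first over \<open>Y\<close> and then over \<open>\<theta>\<close> leaves
  an inner double integral that is integration against \<open>gaussian_pair\<close>. This exhibits
  an explicit version of the law chosen in \<open>cond_mutual_info\<close>.\<close>

lemma cond_\<theta>_Y_L:
  "is_cond_law M (borel \<Otimes>\<^sub>M borel) borel (\<lambda>w. (\<theta> w, Y w)) L (\<lambda>l. gaussian_pair (l\<^sup>2) v)"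
  unfolding is_cond_law_def
proof (intro conjI ballI)
  show K: "(\<lambda>l. gaussian_pair (l\<^sup>2) v) \<in> borel \<rightarrow>\<^sub>M subprob_algebra (borel \<Otimes>\<^sub>M borel)"
    using v by (intro measurable_gaussian_pair) auto
  fix A :: "real set" and B :: "(real \<times> real) set"
  assume A[measurable]: "A \<in> sets borel" and B[measurable]: "B \<in> sets (borel \<Otimes>\<^sub>M borel)"
  note [measurable] = measurable_emeasure_kernel[OF K B]
  let ?k = "\<lambda>t y. ennreal (normal_density t (sqrt v) y)"
  have "emeasure M {w \<in> space M. L w \<in> A \<and> (\<theta> w, Y w) \<in> B}
      = (\<integral>\<^sup>+w. indicator {w \<in> space M. L w \<in> A \<and> (\<theta> w, Y w) \<in> B} w \<partial>M)"
    by simp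
  also have "\<dots> = (\<integral>\<^sup>+w. indicator A (L w) * indicator B (\<theta> w, Y w) \<partial>M)"
    by (intro nn_integral_cong) (auto simp: indicator_def)
  also have "\<dots> = (\<integral>\<^sup>+w. \<integral>\<^sup>+y. ?k (\<theta> w) y * (indicator A (L w) * indicator B (\<theta> w, y)) \<partial>lborel \<partial>M)"
    using nn_integral_L_\<theta>_Y[of "\<lambda>z. indicator A (fst (fst z)) * indicator B (snd (fst z), snd z)"] by simp
  also have "\<dots> = (\<integral>\<^sup>+w. \<integral>\<^sup>+t. \<integral>\<^sup>+y. ?k t y * (indicator A (L w) * indicator B (t, y)) \<partial>lborel
      \<partial>gaussian 0 ((L w)\<^sup>2) \<partial>M)"
    using nn_integral_L_\<theta>[of "\<lambda>(l, t). \<integral>\<^sup>+y. ?k t y * (indicator A l * indicator B (t, y)) \<partial>lborel"]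
    by simp
  also have "\<dots> = (\<integral>\<^sup>+w. \<integral>\<^sup>+z. indicator A (L w) * indicator B z \<partial>gaussian_pair ((L w)\<^sup>2) v \<partial>M)"
    by (intro nn_integral_cong) (simp add: nn_integral_gaussian_pair)
  also have "\<dots> = (\<integral>\<^sup>+w. emeasure (gaussian_pair ((L w)\<^sup>2) v) B * indicator A (L w) \<partial>M)"
    by (intro nn_integral_cong, subst nn_integral_cmult) (simp_all add: mult.commute)
  also have "\<dots> = (\<integral>\<^sup>+l\<in>A. emeasure (gaussian_pair (l\<^sup>2) v) B \<partial>distr M borel L)"
    by (subst nn_integral_distr) auto
  finally show "emeasure M {w \<in> space M. L w \<in> A \<and> (\<theta> w, Y w) \<in> B}
      = (\<integral>\<^sup>+l\<in>A. emeasure (gaussian_pair (l\<^sup>2) v) B \<partial>distr M borel L)" .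
qed

text \<open>The explicit version shows that the choice operator returns a conditional law, and
  uniqueness identifies it with \<open>gaussian_pair\<close> for almost every \<open>l\<close>, so
  the closed form can be inserted.\<close>

lemma cond_mutual_info_eq:
  "cond_mutual_info M borel borel borel \<theta> Y L = (\<integral>\<^sup>+w. ennreal (ln (1 + (L w)\<^sup>2 / v) / 2) \<partial>M)"
proof -
  define K where "K = (SOME K. is_cond_law M (borel \<Otimes>\<^sub>M borel) borel (\<lambda>w. (\<theta> w, Y w)) L K)"
  have K: "is_cond_law M (borel \<Otimes>\<^sub>M borel) borel (\<lambda>w. (\<theta> w, Y w)) L K"
    unfolding K_def
    by (rule someI[where P="is_cond_law M (borel \<Otimes>\<^sub>M borel) borel (\<lambda>w. (\<theta> w, Y w)) L"])
       (rule cond_\<theta>_Y_L)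
  \<comment> \<open>Uniqueness is stated for the Borel sets of one space; on the plane these are the
    product sets by \<open>borel_prod\<close>.\<close>
  have eq: "AE l in distr M borel L. K l = gaussian_pair (l\<^sup>2) v"
    by (rule is_cond_law_unique[OF finite_measure_axioms L _ K cond_\<theta>_Y_L])
       (rule arg_cong[where f=sets, OF borel_prod])
  have pos: "AE l in distr M borel L. 0 < l"
    using L_pos by (subst AE_distr_iff) auto
  have "cond_mutual_info M borel borel borel \<theta> Y L
      = (\<integral>\<^sup>+l. mutual_info (K l) borel borel fst snd \<partial>distr M borel L)"
    by (simp add: cond_mutual_info_def K_def)
  also have "\<dots> = (\<integral>\<^sup>+l. ennreal (ln (1 + l\<^sup>2 / v) / 2) \<partial>distr M borel L)"
    using eq pos
    by (intro nn_integral_cong_AE, eventually_elim) (simp add: mutual_info_gaussian_pair v)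
  also have "\<dots> = (\<integral>\<^sup>+w. ennreal (ln (1 + (L w)\<^sup>2 / v) / 2) \<partial>M)"
    by (rule nn_integral_distr) auto
  finally show ?thesis .
qed

section \<open>Log density ratios and the chain rule\<close>

lemma joint_density_\<theta>_Y:
  "joint_density M borel lborel \<theta> Y (\<lambda>t y. normal_density t (sqrt v) y)"
proof (rule joint_densityI[OF prob_space_axioms lborel.sigma_finite_measure_axioms])
  show "is_cond_law M lborel borel Y \<theta> (\<lambda>t. density lborel (\<lambda>y. ennreal (normal_density t (sqrt v) y)))"
    using cond_Y_\<theta>
    by (simp add: is_cond_law_def gaussian_def cong: subprob_algebra_cong)
  show "normal_density t (sqrt v) y \<le> 1 / sqrt (2 * pi * (sqrt v)\<^sup>2)" for t y
    by (rule normal_density_le)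
qed (use v in \<open>auto intro: normal_density_pos\<close>)

lemma joint_density_L_Y:
  "joint_density M borel lborel L Y (\<lambda>l y. normal_density 0 (sqrt (l\<^sup>2 + v)) y)"
proof (rule joint_densityI[OF prob_space_axioms lborel.sigma_finite_measure_axioms])
  show "is_cond_law M lborel borel Y L
      (\<lambda>l. density lborel (\<lambda>y. ennreal (normal_density 0 (sqrt (l\<^sup>2 + v)) y)))"
    using cond_Y_L
    by (simp add: is_cond_law_def gaussian_def cong: subprob_algebra_cong)
  show "normal_density 0 (sqrt (l\<^sup>2 + v)) y \<le> 1 / sqrt (2 * pi * v)" for l y
    using v by (intro normal_density_sqrt_add_le) auto
qed (use v in \<open>auto intro!: normal_density_pos add_nonneg_pos\<close>)

sublocale \<theta>_Y: joint_density M borel lborel \<theta> Y "\<lambda>t y. normal_density t (sqrt v) y"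
  by (rule joint_density_\<theta>_Y)

sublocale L_Y: joint_density M borel lborel L Y "\<lambda>l y. normal_density 0 (sqrt (l\<^sup>2 + v)) y"
  by (rule joint_density_L_Y)

text \<open>Averaging over \<open>\<theta>\<close> may be done by first averaging given
  \<open>L\<close>, which is the normal mixture. Equality at every point lets both log ratios share
  one denominator.\<close>

lemma marginal_eq: "\<theta>_Y.marginal y = L_Y.marginal y"
proof -
  have "ennreal (\<theta>_Y.marginal y) = (\<integral>\<^sup>+w. ennreal (normal_density (\<theta> w) (sqrt v) y) \<partial>M)"
    by (rule \<theta>_Y.ennreal_marginal) simp
  also have "\<dots> = (\<integral>\<^sup>+w. \<integral>\<^sup>+t. ennreal (normal_density t (sqrt v) y) \<partial>gaussian 0 ((L w)\<^sup>2) \<partial>M)"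
    using nn_integral_L_\<theta>[of "\<lambda>(l, t). ennreal (normal_density t (sqrt v) y)"] by simp
  also have "\<dots> = (\<integral>\<^sup>+w. ennreal (normal_density 0 (sqrt ((L w)\<^sup>2 + v)) y) \<partial>M)"
    using L_pos
    by (intro nn_integral_cong_AE, eventually_elim)
       (simp add: nn_integral_gaussian nn_integral_normal_mixture[OF _ v] del: real_sqrt_abs)
  also have "\<dots> = ennreal (L_Y.marginal y)"
    by (rule L_Y.ennreal_marginal[symmetric]) simp
  finally show ?thesis
    using \<theta>_Y.marginal_pos[of y] L_Y.marginal_pos[of y] by (simp add: less_imp_le)
qed

lemma mutual_info_chain:
  "mutual_info M borel borel \<theta> Y
     = mutual_info M borel borel L Y + (\<integral>\<^sup>+w. ennreal (ln (1 + (L w)\<^sup>2 / v) / 2) \<partial>M)"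
proof -
  let ?m = "\<lambda>w. L_Y.marginal (Y w)" and ?r = "\<lambda>w. normal_density 0 (sqrt ((L w)\<^sup>2 + v)) (Y w)"
  \<comment> \<open>\<open>c\<close> and \<open>b\<close> are the log ratios of the pairs
    (\<open>\<theta>\<close>, \<open>Y\<close>) and (\<open>L\<close>, \<open>Y\<close>),
    \<open>h\<close> is the information at a fixed scale, and \<open>e\<close> is the remainder of
    mean 0 in \<open>c = b + h + e\<close>.\<close>
  define h where "h w = ln (1 + (L w)\<^sup>2 / v) / 2" for w
  define c where "c w = ln (normal_density (\<theta> w) (sqrt v) (Y w)) - ln (?m w)" for w
  define b where "b w = ln (?r w) - ln (?m w)" for w
  define e where "e w = (Y w / sqrt ((L w)\<^sup>2 + v))\<^sup>2 / 2 - ((Y w - \<theta> w) / sqrt v)\<^sup>2 / 2" for w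
  have w_pos: "0 < l\<^sup>2 + v" for l :: real
    using v by (simp add: add_nonneg_pos)
  have [measurable]: "h \<in> borel_measurable M" "b \<in> borel_measurable M"
    unfolding h_def b_def by measurable
  have h_nonneg: "0 \<le> h w" for w
    using v by (simp add: h_def)
  have c_eq: "c w = b w + h w + e w" for w
    using ln_normal_density_ratio[OF v, of "\<theta> w" "Y w" "L w"]
    by (simp add: c_def b_def h_def e_def)
  have 1: "has_bochner_integral M (\<lambda>w. ((Y w - \<theta> w) / sqrt v)\<^sup>2) 1"
    by (rule has_bochner_integral_standardized_square[OF joint_density_\<theta>_Y]) (use v in auto)
  have 2: "has_bochner_integral M (\<lambda>w. ((Y w - 0) / sqrt ((L w)\<^sup>2 + v))\<^sup>2) 1"
    by (rule has_bochner_integral_standardized_square[OF joint_density_L_Y]) (use w_pos in auto)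
  have "has_bochner_integral M e (1 / 2 - 1 / 2)"
    unfolding e_def
    by (intro has_bochner_integral_diff has_bochner_integral_divide_zero 1 2[simplified])
  then have e: "integrable M e" "(\<integral>w. e w \<partial>M) = 0"
    by (auto simp: has_bochner_integral_iff)
  have I\<theta>: "mutual_info M borel borel \<theta> Y = (if integrable M c then ennreal (\<integral>w. c w \<partial>M) else \<infinity>)"
    unfolding c_def marginal_eq[symmetric] using \<theta>_Y.mutual_info_eq
    by (subst mutual_info_cong_sets[where S'=borel and T'=lborel]) simp_all
  have IL: "mutual_info M borel borel L Y = (if integrable M b then ennreal (\<integral>w. b w \<partial>M) else \<infinity>)"
    unfolding b_def using L_Y.mutual_info_eq
    by (subst mutual_info_cong_sets[where S'=borel and T'=lborel]) simp_all
  \<comment> \<open>Only \<open>b\<close> and \<open>h\<close> can fail to be integrable, and since \<open>h \<ge> 0\<close> and \<open>b \<ge> 1 - m / r\<close> with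
    integrable \<open>m / r\<close>, no cancellation can make \<open>c\<close> integrable when one of them is not.\<close>
  show ?thesis
  proof (cases "integrable M b \<and> integrable M h")
    case True
    then have b: "integrable M b" and h: "integrable M h" by auto
    have c: "integrable M c"
      unfolding c_eq[abs_def] using b h e by simp
    have "(\<integral>w. c w \<partial>M) = (\<integral>w. b w \<partial>M) + (\<integral>w. h w \<partial>M)"
      unfolding c_eq[abs_def] using b h e by simp
    \<comment> \<open>With both expectations nonnegative, \<open>ennreal\<close> of their sum splits
      into the sum of the two terms.\<close>
    moreover have "0 \<le> (\<integral>w. b w \<partial>M)"
      using L_Y.log_ratio_expectation_nonneg b by (simp add: b_def[abs_def])
    moreover have "(\<integral>\<^sup>+w. ennreal (h w) \<partial>M) = ennreal (\<integral>w. h w \<partial>M)"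
      using h h_nonneg by (intro nn_integral_eq_integral) auto
    moreover have "0 \<le> (\<integral>w. h w \<partial>M)"
      using h_nonneg by simp
    ultimately show ?thesis
      using b c by (simp add: I\<theta> IL h_def[abs_def])
  next
    case False
    have "\<not> integrable M c"
    proof
      assume c: "integrable M c"
      have ratio: "integrable M (\<lambda>w. ?m w / ?r w)"
        using L_Y.has_bochner_integral_inverse_ratio by (simp add: has_bochner_integral_iff)
      have b_ge: "1 - ?m w / ?r w \<le> b w" if "w \<in> space M" for w
        using L_Y.log_ratio_ge[OF that] by (simp add: b_def)
      have ratio_nonneg: "0 \<le> ?m w / ?r w" for w
        using L_Y.marginal_pos[of "Y w"] by (simp add: less_imp_le)
      \<comment> \<open>The dominating function comes from \<open>h = c - b - e\<close> and the
        lower bound on \<open>b\<close>, which give \<open>h \<le> c - e + ?m / ?r - 1\<close>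
        pointwise.\<close>
      have h: "integrable M h"
      proof (rule Bochner_Integration.integrable_bound)
        show "integrable M (\<lambda>w. \<bar>c w\<bar> + \<bar>e w\<bar> + ?m w / ?r w)"
          using c e ratio by simp
        show "AE w in M. norm (h w) \<le> norm (\<bar>c w\<bar> + \<bar>e w\<bar> + ?m w / ?r w)"
        proof (rule AE_I2)
          fix w assume "w \<in> space M"
          then show "norm (h w) \<le> norm (\<bar>c w\<bar> + \<bar>e w\<bar> + ?m w / ?r w)"
            using b_ge[of w] ratio_nonneg[of w] h_nonneg[of w] c_eq[of w]
            unfolding real_norm_def by linarith
        qed
      qed measurable
      have "b = (\<lambda>w. c w - h w - e w)"
        by (simp add: fun_eq_iff c_eq)
      then have "integrable M b"
        using c h e by simp
      with h False show False by simp
    qed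
    moreover have "mutual_info M borel borel L Y + (\<integral>\<^sup>+w. ennreal (h w) \<partial>M) = \<infinity>"
    proof (cases "integrable M b")
      case True
      then have "\<not> integrable M h" using False by simp
      then have "(\<integral>\<^sup>+w. ennreal (h w) \<partial>M) = \<infinity>"
        using h_nonneg by (simp add: integrable_iff_bounded less_top[symmetric])
      then show ?thesis by simp
    qed (simp add: IL)
    ultimately show ?thesis
      by (simp only: I\<theta> h_def if_False)
  qed
qed

end

theorem mainTheorem7:
  fixes M :: "'w measure" and L \<theta> Y :: "'w \<Rightarrow> real" and \<sigma> :: real and n :: nat
  assumes "prob_space M"
    and "\<sigma> > 0" and "n \<ge> 1"
    and "L \<in> borel_measurable M" and "\<theta> \<in> borel_measurable M" and "Y \<in> borel_measurable M"
    and "AE w in M. L w > 0"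
    and "is_cond_law M borel borel \<theta> L (\<lambda>l. gaussian 0 (l\<^sup>2))"
    and "is_cond_law M borel (borel \<Otimes>\<^sub>M borel) Y (\<lambda>w. (L w, \<theta> w))
           (\<lambda>(l, t). gaussian t (\<sigma>\<^sup>2 / real n))"
  shows "mutual_info M borel borel \<theta> Y
           = mutual_info M borel borel L Y + cond_mutual_info M borel borel borel \<theta> Y L
       \<and> mutual_info M borel borel L Y + cond_mutual_info M borel borel borel \<theta> Y L
           = mutual_info M borel borel L Y
             + 1 / 2 * (\<integral>\<^sup>+w. ennreal (ln (1 + real n * (L w)\<^sup>2 / \<sigma>\<^sup>2)) \<partial>M)"
proof -
  interpret prob_space M by fact
  interpret gaussian_scale_mixture M L \<theta> Y "\<sigma>\<^sup>2 / real n"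
    by unfold_locales (use assms in auto)
  \<comment> \<open>No sign condition on \<open>x\<close> is required, since both sides are 0 for
    negative \<open>x\<close>.\<close>
  have half: "ennreal (x / 2) = 1 / 2 * ennreal x" for x :: real
    using ennreal_mult'[of "1 / 2" x] by (simp add: divide_ennreal_def)
  have [measurable]: "L \<in> borel_measurable M" by fact
  have "(\<integral>\<^sup>+w. ennreal (ln (1 + (L w)\<^sup>2 / (\<sigma>\<^sup>2 / real n)) / 2) \<partial>M)
      = 1 / 2 * (\<integral>\<^sup>+w. ennreal (ln (1 + real n * (L w)\<^sup>2 / \<sigma>\<^sup>2)) \<partial>M)"
    unfolding half by (subst nn_integral_cmult) (auto simp: mult.commute)
  then show ?thesis
    using mutual_info_chain cond_mutual_info_eq by simp
qed

end
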